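(* Let $X=[x_1,\dots,x_n]$ be a finite set of vectors in $\mathbb{R}^m$ having an MSS $\{X_1,\dots,X_K\}$ (without pure segment), with $\mathcal S_k=\mathrm{span}(X_k)$, $d_k=r(X_k)$, $n_k=n(X_k)$, $d=\sum_k d_k$, and column index sets $J_k^*$, such that (i) $x_j\notin\mathcal S_k\cap\mathcal S_\ell$ for all $j\le n$, $k\neq\ell$, and (ii) $\{X_1,\dots,X_K\}$ is intersected nondegenerately. Assume $n_k>d_k+(K-1)d_0$ for all $k$, and let $J=\{J_1,\dots,J_K\}\in\mathcal J(K,d,d_{\min})$. Let $\tilde J=\{\tilde J_1,\dots,\tilde J_K\}$ be the result of applying segment extension one-by-one to all the extendable segments of $J$. Then each nonempty $\tilde J_i$ is a union of some of the index sets $J_k^*$ of the MSS. Furthermore, $\tilde J=J^*=\{J_1^*,\dots,J_K^*\}$ if all the $\tilde J_i$ are nonempty.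
   Context: A real matrix $X=[x_1,\dots,x_n]$ is identified with the (indexed) finite set of its columns; a subset is a column submatrix. $r(X')$ and $n(X')$ denote rank and number of columns, $\mathrm{span}(X')$ the column space, and $X_{J}$ the submatrix of columns indexed by $J$. $X\setminus X'$ denotes the remaining columns. A set $X'$ is nondegenerate if every subset with rank smaller than $r(X')$ is of full column rank. $\mathrm{span}(X')$ (with its spanning set $X'$) is minimal if $n(X')>r(X')$ and $X'$ is nondegenerate. An MSS of $X$ without pure segment is a partition of the columns of $X$ into nonempty segments $X_1,\dots,X_K$ such that each $\mathrm{span}(X_k)$ is minimal and $\mathrm{span}(X_k)\ne\mathrm{span}(X_\ell)$ for $k\neq\ell$. $\{X_k\}$ is intersected nondegenerately if for every $k$ and every subset $X_k'$ of $X\setminus X_k$: with $\mathcal S_k'=\mathrm{span}(X_k)\cap\mathrm{span}(X_k')$ and $\mathcal S_k''$ the orthogonal complement of $\mathcal S_k'$ within $\mathrm{span}(X_k)$, in the columnwise splitting $X_k=Y_k+Z_k$ with columns of $Y_k$ in $\mathcal S_k'$ and of $Z_k$ in $\mathcal S_k''$, $Z_k$ is zero or nondegenerate. Notation: $d_{\min}=\min_k d_k$, $d_0=\max_k\dim\big(\mathcal S_k\cap\sum_{j\ne k}\mathcal S_j\big)$. $\mathcal J(K,d,d_{\min})$ is the set of all partitions $J=\{J_1,\dots,J_K\}$ of $\{1,\dots,n\}$ into $K$ pieces with $\min_k|J_k|>d_{\min}$ and $\sum_k r(X_{J_k})\le d$. $J_i$ is extendable if there is $j\notin J_i$ with $x_j\in\mathrm{span}(X_{J_i})$.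 Segment extension of $J_i$ replaces $J_i$ by $\{j: x_j\in\mathrm{span}(X_{J_i})\}$ and removes the added indices from the other pieces. Extending one-by-one means going through the pieces $i=1,\dots,K$ in some (arbitrary) order, each time extending the current version of the $i$-th piece if it is nonempty and extendable; pieces may become empty. *)

theory Defs
  imports "HOL-Analysis.Analysis" "HOL-Library.Set_Algebras"
begin

text \<open>A matrix \<open>X = [x\<^sub>1, \<dots>, x\<^sub>n]\<close> is represented by its columns \<open>x 1, \<dots>, x n\<close>. A column
  submatrix is a set \<open>J \<subseteq> {1..n}\<close> of indices rather than a set of vectors, so that repeated
  columns are counted with multiplicity.\<close>

definition cspan :: "(nat \<Rightarrow> real ^ 'm) \<Rightarrow> nat set \<Rightarrow> (real ^ 'm) set" where
  "cspan x J = span (x ` J)"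

definition crank :: "(nat \<Rightarrow> real ^ 'm) \<Rightarrow> nat set \<Rightarrow> nat" where
  "crank x J = dim (x ` J)"

definition nondegenerate :: "(nat \<Rightarrow> real ^ 'm) \<Rightarrow> nat set \<Rightarrow> bool" where
  "nondegenerate x J \<longleftrightarrow> (\<forall>J'\<subseteq>J. crank x J' < crank x J \<longrightarrow> crank x J' = card J')"

definition minimal_span :: "(nat \<Rightarrow> real ^ 'm) \<Rightarrow> nat set \<Rightarrow> bool" where
  "minimal_span x J \<longleftrightarrow> card J > crank x J \<and> nondegenerate x J"

definition indexed_partition :: "nat \<Rightarrow> nat \<Rightarrow> (nat \<Rightarrow> nat set) \<Rightarrow> bool" where
  "indexed_partition n K J \<longleftrightarrow>
     (\<Union>k\<in>{1..K}. J k) = {1..n} \<and> disjoint_family_on J {1..K} \<and> (\<forall>k\<in>{1..K}. J k \<noteq> {})"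

text \<open>Minimal subspace segmentation without pure segment.\<close>

definition is_MSS :: "(nat \<Rightarrow> real ^ 'm) \<Rightarrow> nat \<Rightarrow> nat \<Rightarrow> (nat \<Rightarrow> nat set) \<Rightarrow> bool" where
  "is_MSS x n K Js \<longleftrightarrow> indexed_partition n K Js \<and>
     (\<forall>k\<in>{1..K}. minimal_span x (Js k)) \<and>
     (\<forall>k\<in>{1..K}. \<forall>l\<in>{1..K}. k \<noteq> l \<longrightarrow> cspan x (Js k) \<noteq> cspan x (Js l))"

text \<open>The columnwise splitting \<open>x j = y j + z j\<close> for \<open>j \<in> Js k\<close> exists and is unique, because
  \<open>x j\<close> lies in \<open>cspan x (Js k)\<close>; the quantification over \<open>y\<close> and \<open>z\<close> just names it.\<close>

definition intersected_nondegenerately ::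
    "(nat \<Rightarrow> real ^ 'm) \<Rightarrow> nat \<Rightarrow> nat \<Rightarrow> (nat \<Rightarrow> nat set) \<Rightarrow> bool" where
  "intersected_nondegenerately x n K Js \<longleftrightarrow>
     (\<forall>k\<in>{1..K}. \<forall>L \<subseteq> {1..n} - Js k.
        let S' = cspan x (Js k) \<inter> cspan x L;
            S'' = cspan x (Js k) \<inter> orthogonal_comp S'
        in \<forall>y z. (\<forall>j\<in>Js k. x j = y j + z j \<and> y j \<in> S' \<and> z j \<in> S'') \<longrightarrow>
             (\<forall>j\<in>Js k. z j = 0) \<or> nondegenerate z (Js k))"

text \<open>The sum over \<open>j\<close> in \<open>d_zero\<close> is the Minkowski sum of subspaces.\<close>

definition d_zero :: "(nat \<Rightarrow> real ^ 'm) \<Rightarrow> nat \<Rightarrow> (nat \<Rightarrow> nat set) \<Rightarrow> nat" where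
  "d_zero x K Js =
     (MAX k\<in>{1..K}. dim (cspan x (Js k) \<inter> (\<Sum>j\<in>{1..K} - {k}. cspan x (Js j))))"

definition d_min :: "(nat \<Rightarrow> real ^ 'm) \<Rightarrow> nat \<Rightarrow> (nat \<Rightarrow> nat set) \<Rightarrow> nat" where
  "d_min x K Js = (MIN k\<in>{1..K}. crank x (Js k))"

definition candidates ::
    "(nat \<Rightarrow> real ^ 'm) \<Rightarrow> nat \<Rightarrow> nat \<Rightarrow> nat \<Rightarrow> nat \<Rightarrow> (nat \<Rightarrow> nat set) set" where
  "candidates x n K d dm =
     {J. indexed_partition n K J \<and> (MIN k\<in>{1..K}. card (J k)) > dm \<and>
         (\<Sum>k\<in>{1..K}. crank x (J k)) \<le> d}"

definition extendable :: "(nat \<Rightarrow> real ^ 'm) \<Rightarrow> nat \<Rightarrow> nat set \<Rightarrow> bool" where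
  "extendable x n I \<longleftrightarrow> (\<exists>j\<in>{1..n}. j \<notin> I \<and> x j \<in> cspan x I)"

definition extension :: "(nat \<Rightarrow> real ^ 'm) \<Rightarrow> nat \<Rightarrow> nat set \<Rightarrow> nat set" where
  "extension x n I = {j\<in>{1..n}. x j \<in> cspan x I}"

definition segment_extension ::
    "(nat \<Rightarrow> real ^ 'm) \<Rightarrow> nat \<Rightarrow> nat \<Rightarrow> (nat \<Rightarrow> nat set) \<Rightarrow> nat \<Rightarrow> nat set" where
  "segment_extension x n i J =
     (\<lambda>l. if l = i then extension x n (J i) else J l - (extension x n (J i) - J i))"

definition extension_step ::
    "(nat \<Rightarrow> real ^ 'm) \<Rightarrow> nat \<Rightarrow> nat \<Rightarrow> (nat \<Rightarrow> nat set) \<Rightarrow> nat \<Rightarrow> nat set" where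
  "extension_step x n i J =
     (if J i \<noteq> {} \<and> extendable x n (J i) then segment_extension x n i J else J)"

text \<open>One pass over the pieces, in the order in which their indices occur in the list.\<close>

definition extend_one_by_one ::
    "(nat \<Rightarrow> real ^ 'm) \<Rightarrow> nat \<Rightarrow> nat list \<Rightarrow> (nat \<Rightarrow> nat set) \<Rightarrow> nat \<Rightarrow> nat set" where
  "extend_one_by_one x n ord J = fold (extension_step x n) ord J"

end

theory Submission
  imports Defs
begin

text \<open>Nondegenerate intersection says that adding columns \<open>A\<close> of \<open>X\<^sub>k\<close> to columns \<open>L\<close> outside
  \<open>X\<^sub>k\<close> raises the rank by \<open>card A\<close> for as long as \<open>S\<^sub>k\<close> is not swallowed. This has two uses.
  First, a piece whose span does not contain \<open>S\<^sub>k\<close> gains no column of \<open>X\<^sub>k\<close> when it is extended,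
  so that segment extension moves an \<open>X\<^sub>k\<close> that lies in one piece only as a whole. Secondly, build
  the rank of each piece up through \<open>X\<^sub>1, \<dots>, X\<^sub>K\<close>: an \<open>S\<^sub>k\<close> that no piece spans contributes
  \<open>n\<^sub>k > d\<^sub>k + (K - 1) d\<^sub>0\<close> to the sum of the ranks, and each other \<open>S\<^sub>l\<close> contributes at least
  \<open>d\<^sub>l - d\<^sub>0\<close>, which exceeds \<open>d\<close>. Extension never increases the sum of the ranks, so at the end every
  \<open>S\<^sub>k\<close> is spanned by some piece, which contained all of \<open>X\<^sub>k\<close> once it had been extended.\<close>

section \<open>Spans, ranks and Minkowski sums of subspaces\<close>

lemma cspan_mono: "I \<subseteq> I' \<Longrightarrow> cspan x I \<subseteq> cspan x I'"
  unfolding cspan_def by (intro span_mono image_mono)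

lemma crank_mono: "I \<subseteq> I' \<Longrightarrow> crank x I \<le> crank x I'"
  unfolding crank_def by (intro dim_subset image_mono)

lemma subspace_cspan: "subspace (cspan x I)"
  unfolding cspan_def by simp

lemma dim_cspan: "dim (cspan x I) = crank x I"
  unfolding cspan_def crank_def by simp

lemma cspan_superset: "j \<in> I \<Longrightarrow> x j \<in> cspan x I"
  unfolding cspan_def by (simp add: span_base)

lemma cspan_minimal: "(\<And>j. j \<in> I \<Longrightarrow> x j \<in> T) \<Longrightarrow> subspace T \<Longrightarrow> cspan x I \<subseteq> T"
  unfolding cspan_def by (intro span_minimal) auto

lemma crank_Un_le:
  assumes "finite A"
  shows "crank x (L \<union> A) \<le> crank x L + card A"
  using assms by (induction A rule: finite_induct) (auto simp: crank_def dim_insert)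

text \<open>The dimension formula for the sum of \<open>S\<close> and \<open>T\<close>, which lies
  inside \<open>U\<close>. It bounds the rank of a union from below once the overlap is
  controlled.\<close>

lemma dim_add_le:
  fixes S T U :: "'a::euclidean_space set"
  assumes "subspace S" "subspace T" "subspace U" "S \<subseteq> U" "T \<subseteq> U"
  shows "dim S + dim T \<le> dim U + dim (S \<inter> T)"
proof -
  have "{a + b |a b. a \<in> S \<and> b \<in> T} \<subseteq> U"
    using assms by (auto intro!: subspace_add)
  then have "dim {a + b |a b. a \<in> S \<and> b \<in> T} \<le> dim U"
    by (rule dim_subset)
  then show ?thesis
    using dim_sums_Int[OF assms(1,2)] by linarith
qed

lemma subspace_sum_sets:
  fixes S :: "'i \<Rightarrow> 'a::real_vector set"
  assumes "finite I" "\<And>i. i \<in> I \<Longrightarrow> subspace (S i)"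
  shows "subspace (\<Sum>i\<in>I. S i)"
  using assms
proof (induction I rule: finite_induct)
  case empty
  then show ?case by (simp add: set_zero)
next
  case (insert i I)
  have "S i + (\<Sum>i\<in>I. S i) = {a + b |a b. a \<in> S i \<and> b \<in> (\<Sum>i\<in>I. S i)}"
    by (auto simp: set_plus_def)
  moreover have "subspace {a + b |a b. a \<in> S i \<and> b \<in> (\<Sum>i\<in>I. S i)}"
    using insert by (intro subspace_sums) auto
  ultimately show ?case using insert by simp
qed

lemma subset_sum_sets:
  fixes S :: "'i \<Rightarrow> 'a::real_vector set"
  assumes "finite I" "\<And>i. i \<in> I \<Longrightarrow> 0 \<in> S i" "k \<in> I"
  shows "S k \<subseteq> (\<Sum>i\<in>I. S i)"
proof
  fix v assume v: "v \<in> S k"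
  \<comment> \<open>The summand \<open>v\<close> is put at index \<open>k\<close> and 0 everywhere
    else.\<close>
  have "v = (\<Sum>i\<in>I. if i = k then v else 0)"
    using assms by simp
  then show "v \<in> (\<Sum>i\<in>I. S i)"
    using v assms(2) unfolding set_sum_alt[OF assms(1)]
    by (intro CollectI exI[of _ "\<lambda>i. if i = k then v else 0"]) auto
qed

section \<open>Rank growth when columns of one segment are added\<close>

text \<open>Each column in \<open>L\<close> belongs to another segment, so \<open>cspan x L\<close>
  lies in the sum of the other subspaces, whose overlap with \<open>cspan x (Js k)\<close> is what
  \<open>d_zero\<close> maximises.\<close>

lemma dim_Int_cspan_le_d_zero:
  assumes part: "indexed_partition n K Js" and k: "k \<in> {1..K}" and L: "L \<subseteq> {1..n} - Js k"
  shows "dim (cspan x (Js k) \<inter> cspan x L) \<le> d_zero x K Js"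
proof -
  let ?T = "\<Sum>j\<in>{1..K} - {k}. cspan x (Js j)"
  have "cspan x L \<subseteq> ?T"
  proof (rule cspan_minimal)
    fix j assume "j \<in> L"
    then obtain l where l: "l \<in> {1..K} - {k}" "j \<in> Js l"
      using L part unfolding indexed_partition_def by blast
    have "cspan x (Js l) \<subseteq> ?T"
      using l by (intro subset_sum_sets) (auto intro: subspace_0 subspace_cspan)
    then show "x j \<in> ?T" using l cspan_superset by blast
  next
    show "subspace ?T" by (intro subspace_sum_sets) (auto intro: subspace_cspan)
  qed
  then have "dim (cspan x (Js k) \<inter> cspan x L) \<le> dim (cspan x (Js k) \<inter> ?T)"
    by (intro dim_subset) auto
  also have "\<dots> \<le> d_zero x K Js"
    unfolding d_zero_def using k by (intro Max_ge) auto
  finally show ?thesis .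
qed

text \<open>With \<open>S\<close>, \<open>V\<close>, \<open>W\<close> as in the proof, replace each
  column of \<open>A\<close> by its component \<open>z j\<close> orthogonal to
  \<open>S \<inter> V\<close>. As \<open>S\<close> is not inside \<open>W\<close>, nondegeneracy
  makes these components independent. Their span lies in \<open>W\<close> and meets \<open>V\<close>
  only in 0, so it adds \<open>card A\<close> dimensions to \<open>V\<close>.\<close>

lemma crank_Un_nondegenerate:
  assumes nondeg: "intersected_nondegenerately x n K Js"
    and k: "k \<in> {1..K}" and L: "L \<subseteq> {1..n} - Js k" and A: "A \<subseteq> Js k"
    and nspan: "\<not> cspan x (Js k) \<subseteq> cspan x (L \<union> A)"
  shows "crank x L + card A \<le> crank x (L \<union> A)"
proof -
  define S where "S = cspan x (Js k)"
  define V where "V = cspan x L"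
  define W where "W = cspan x (L \<union> A)"
  have sub: "subspace S" "subspace V" "subspace W" "subspace (S \<inter> V)"
    by (simp_all add: S_def V_def W_def subspace_cspan subspace_inter)
  have VW: "V \<subseteq> W" unfolding V_def W_def by (intro cspan_mono) auto
  \<comment> \<open>The splitting is made for every index, so that choice yields total functions
    \<open>y\<close> and \<open>z\<close>. That \<open>z j\<close> lies in \<open>S\<close> holds on
    the segment and is shown separately.\<close>
  have "\<exists>y z. x j = y + z \<and> y \<in> S \<inter> V \<and> z \<in> orthogonal_comp (S \<inter> V)" for j
  proof -
    obtain y z where yz: "y \<in> span (S \<inter> V)" "\<And>w. w \<in> span (S \<inter> V) \<Longrightarrow> orthogonal z w"
        "x j = y + z"
      using orthogonal_subspace_decomp_exists[of "S \<inter> V" "x j"] by metis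
    have "z \<in> orthogonal_comp (S \<inter> V)"
      using yz(2) by (auto simp: orthogonal_comp_def orthogonal_commute span_base)
    moreover have "y \<in> S \<inter> V" using yz(1) sub(4) by (metis span_eq_iff)
    ultimately show ?thesis using yz(3) by blast
  qed
  then have "\<forall>j. \<exists>y z. x j = y + z \<and> y \<in> S \<inter> V \<and> z \<in> orthogonal_comp (S \<inter> V)"
    by (intro allI)
  then have "\<exists>y z. \<forall>j. x j = y j + z j \<and> y j \<in> S \<inter> V \<and> z j \<in> orthogonal_comp (S \<inter> V)"
    unfolding choice_iff .
  then obtain y z where yz: "\<And>j. x j = y j + z j" "\<And>j. y j \<in> S \<inter> V"
      "\<And>j. z j \<in> orthogonal_comp (S \<inter> V)"
    by blast
  have zS: "z j \<in> S" if "j \<in> Js k" for j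
  proof -
    have "z j = x j - y j" using yz(1)[of j] by simp
    moreover have "x j \<in> S" using that by (simp add: S_def cspan_superset)
    ultimately show ?thesis using yz(2)[of j] sub(1) by (auto intro: subspace_diff)
  qed
  have "(\<forall>j\<in>Js k. z j = 0) \<or> nondegenerate z (Js k)"
    using yz zS
    by (intro nondeg[unfolded intersected_nondegenerately_def Let_def, rule_format, OF k L,
          where y = y])
      (simp add: S_def V_def)
  moreover have "\<not> (\<forall>j\<in>Js k. z j = 0)"
  proof
    assume "\<forall>j\<in>Js k. z j = 0"
    then have "S \<subseteq> W"
      unfolding S_def
    proof (intro cspan_minimal)
      fix j assume "j \<in> Js k"
      then have "x j = y j" using \<open>\<forall>j\<in>Js k. z j = 0\<close> yz(1)[of j] by simp
      then show "x j \<in> W" using yz(2)[of j] VW by auto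
    qed (rule sub(3))
    then show False using nspan by (simp add: S_def W_def)
  qed
  ultimately have nd: "nondegenerate z (Js k)" by blast
  have zW: "cspan z A \<subseteq> W"
  proof (rule cspan_minimal)
    fix j assume "j \<in> A"
    then have "x j \<in> W" by (simp add: W_def cspan_superset)
    moreover have "z j = x j - y j" using yz(1)[of j] by simp
    ultimately show "z j \<in> W" using yz(2)[of j] VW sub(3) by (auto intro: subspace_diff)
  qed (fact sub)
  \<comment> \<open>Nondegeneracy gives independence only below full rank. At full rank,
    \<open>z\<close> on \<open>A\<close> would span every \<open>z j\<close> of the segment; since
    each \<open>y j\<close> is in \<open>V\<close>, all of \<open>S\<close> would fall into
    \<open>W\<close>.\<close>
  have "crank z A \<noteq> crank z (Js k)"
  proof
    assume "crank z A = crank z (Js k)"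
    then have eq: "cspan z A = cspan z (Js k)"
      using A by (intro subspace_dim_equal) (auto simp: dim_cspan subspace_cspan cspan_mono)
    have "S \<subseteq> W"
      unfolding S_def
    proof (rule cspan_minimal)
      fix j assume "j \<in> Js k"
      then have "z j \<in> W" using eq zW cspan_superset by blast
      moreover have "y j \<in> W" using yz(2) VW by blast
      ultimately show "x j \<in> W" using yz(1)[of j] sub(3) by (simp add: subspace_add)
    qed (fact sub)
    then show False using nspan by (simp add: S_def W_def)
  qed
  with crank_mono[OF A, of z] have "crank z A = card A"
    using nd A unfolding nondegenerate_def by auto
  \<comment> \<open>A common vector lies in \<open>S \<inter> V\<close> and is orthogonal to
    \<open>S \<inter> V\<close>, hence to itself.\<close>
  moreover have "V \<inter> cspan z A \<subseteq> {0}"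
  proof
    fix v assume v: "v \<in> V \<inter> cspan z A"
    have "cspan z A \<subseteq> S" using A zS sub(1) by (intro cspan_minimal) auto
    moreover have "cspan z A \<subseteq> orthogonal_comp (S \<inter> V)"
      using yz(3) by (intro cspan_minimal) (auto simp: subspace_orthogonal_comp)
    ultimately have "orthogonal v v" using v by (auto simp: orthogonal_comp_def)
    then show "v \<in> {0}" by (simp add: orthogonal_self)
  qed
  then have "dim (V \<inter> cspan z A) = 0" by simp
  ultimately show ?thesis
    using dim_add_le[OF sub(2) subspace_cspan sub(3) VW zW]
    unfolding V_def W_def dim_cspan by linarith
qed

text \<open>The counterpart for a swallowed segment: both \<open>cspan x L\<close> and
  \<open>cspan x (Js k)\<close> lie in the larger span, and they overlap in at most
  \<open>d_zero\<close> dimensions.\<close>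

lemma crank_Un_spanning:
  assumes "indexed_partition n K Js" "k \<in> {1..K}" "L \<subseteq> {1..n} - Js k"
    and "cspan x (Js k) \<subseteq> cspan x (L \<union> A)"
  shows "crank x L + crank x (Js k) \<le> crank x (L \<union> A) + d_zero x K Js"
  using dim_add_le[OF subspace_cspan subspace_cspan subspace_cspan assms(4), of x L]
    dim_Int_cspan_le_d_zero[OF assms(1-3), of x] cspan_mono[of L "L \<union> A" x]
  by (simp add: dim_cspan)

text \<open>If \<open>j\<close> were new, adding it to \<open>I\<close> would change neither the
  span nor the rank. But the segment stays unspanned, so \<open>card ?A + 1\<close> columns would
  raise the rank over \<open>?L\<close> by their full number, whereas \<open>I\<close> reaches at
  most \<open>crank x ?L + card ?A\<close>.\<close>

lemma mem_cspan_imp_mem: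
  assumes nondeg: "intersected_nondegenerately x n K Js" and fin: "finite (Js k)"
    and k: "k \<in> {1..K}" and I: "I \<subseteq> {1..n}"
    and nspan: "\<not> cspan x (Js k) \<subseteq> cspan x I" and j: "j \<in> Js k" "x j \<in> cspan x I"
  shows "j \<in> I"
proof (rule ccontr)
  assume "j \<notin> I"
  let ?L = "I - Js k" and ?A = "I \<inter> Js k"
  have span_eq: "cspan x (insert j I) = cspan x I"
    using j(2) unfolding cspan_def by (simp add: span_redundant)
  then have rank_eq: "crank x (insert j I) = crank x I"
    by (simp flip: dim_cspan)
  have split: "?L \<union> insert j ?A = insert j I" using j by auto
  have "crank x ?L + card (insert j ?A) \<le> crank x (?L \<union> insert j ?A)"
  proof (rule crank_Un_nondegenerate[OF nondeg k])
    show "\<not> cspan x (Js k) \<subseteq> cspan x (?L \<union> insert j ?A)"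
      unfolding split span_eq by (fact nspan)
  qed (use I j in auto)
  moreover have "crank x (?L \<union> ?A) \<le> crank x ?L + card ?A"
    using fin by (intro crank_Un_le) auto
  moreover have "?L \<union> ?A = I" by auto
  moreover have "card (insert j ?A) = Suc (card ?A)"
    using \<open>j \<notin> I\<close> fin by simp
  ultimately show False
    unfolding split rank_eq by simp
qed

section \<open>Counting ranks over pieces and segments\<close>

lemma exists_spanning_piece:
  assumes part: "indexed_partition n K Js"
    and nondeg: "intersected_nondegenerately x n K Js"
    and sizes: "\<forall>k\<in>{1..K}. card (Js k) > crank x (Js k) + (K - 1) * d_zero x K Js"
    and cover: "(\<Union>i\<in>{1..K}. J i) = {1..n}" and disj: "disjoint_family_on J {1..K}"
    and rank: "(\<Sum>i\<in>{1..K}. crank x (J i)) \<le> (\<Sum>k\<in>{1..K}. crank x (Js k))"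
    and k: "k \<in> {1..K}"
  shows "\<exists>i\<in>{1..K}. cspan x (Js k) \<subseteq> cspan x (J i)"
proof (rule ccontr)
  assume no_span: "\<not> ?thesis"
  \<comment> \<open>\<open>P i t\<close> is the part of piece \<open>i\<close> in the first
    \<open>t\<close> segments, and \<open>c i t\<close> is the rank gained at segment
    \<open>t\<close>. Since \<open>{1..0}\<close> is empty, the gains telescope from 0 to the rank
    of \<open>J i\<close>. Integers avoid truncated subtraction.\<close>
  define P where "P i t = J i \<inter> (\<Union>l\<in>{1..t}. Js l)" for i t
  define c where "c i t = int (crank x (P i t)) - int (crank x (P i (t - 1)))" for i t
  have Js_cover: "(\<Union>l\<in>{1..K}. Js l) = {1..n}" and Js_disj: "disjoint_family_on Js {1..K}"
    using part by (auto simp: indexed_partition_def)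
  have P_step: "P i t = P i (t - 1) \<union> (J i \<inter> Js t)" if "t \<in> {1..K}" for i t
  proof -
    have "{1..t} = insert t {1..t - 1}" using that by auto
    then show ?thesis unfolding P_def by auto
  qed
  have P_out: "P i (t - 1) \<subseteq> {1..n} - Js t" if t: "t \<in> {1..K}" for i t
  proof
    fix j assume "j \<in> P i (t - 1)"
    then obtain l where l: "l \<in> {1..t - 1}" "j \<in> Js l" unfolding P_def by auto
    then have "l \<in> {1..K}" "l \<noteq> t" using t by auto
    then show "j \<in> {1..n} - Js t"
      using l Js_cover Js_disj t unfolding disjoint_family_on_def by blast
  qed
  have c_nonneg: "0 \<le> c i t" if "t \<in> {1..K}" for i t
    using crank_mono[of "P i (t - 1)" "P i t" x] P_step[OF that] unfolding c_def by auto
  have c_sum: "(\<Sum>t\<in>{1..K}. c i t) = int (crank x (J i))" if "i \<in> {1..K}" for i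
  proof -
    have "P i K = J i" "P i 0 = {}" using Js_cover cover that by (auto simp: P_def)
    then show ?thesis
      unfolding c_def using sum_telescope''[of 0 K "\<lambda>t. int (crank x (P i t))"]
      by (simp add: crank_def)
  qed
  \<comment> \<open>The pieces cut \<open>Js t\<close> into disjoint shares, and each piece gains at
    least the size of its share.\<close>
  have unspanned: "int (card (Js t)) \<le> (\<Sum>i\<in>{1..K}. c i t)"
    if t: "t \<in> {1..K}" and ns: "\<forall>i\<in>{1..K}. \<not> cspan x (Js t) \<subseteq> cspan x (P i t)" for t
  proof -
    have "Js t = (\<Union>i\<in>{1..K}. J i \<inter> Js t)" using Js_cover cover t by blast
    moreover have "card (\<Union>i\<in>{1..K}. J i \<inter> Js t) = (\<Sum>i\<in>{1..K}. card (J i \<inter> Js t))"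
    proof (rule card_UN_disjoint)
      have "finite (J i)" if "i \<in> {1..K}" for i
        using cover that by (intro finite_subset[of "J i" "{1..n}"]) auto
      then show "\<forall>i\<in>{1..K}. finite (J i \<inter> Js t)" by blast
      show "\<forall>i\<in>{1..K}. \<forall>j\<in>{1..K}. i \<noteq> j \<longrightarrow> (J i \<inter> Js t) \<inter> (J j \<inter> Js t) = {}"
        using disj unfolding disjoint_family_on_def by blast
    qed simp
    ultimately have "int (card (Js t)) = (\<Sum>i\<in>{1..K}. int (card (J i \<inter> Js t)))"
      by simp
    also have "\<dots> \<le> (\<Sum>i\<in>{1..K}. c i t)"
    proof (rule sum_mono)
      fix i assume i: "i \<in> {1..K}"
      show "int (card (J i \<inter> Js t)) \<le> c i t"
        using crank_Un_nondegenerate[OF nondeg t P_out[OF t], of "J i \<inter> Js t" i] ns i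
        unfolding c_def P_step[OF t, symmetric] by auto
    qed
    finally show ?thesis .
  qed
  \<comment> \<open>One piece spanning segment \<open>t\<close> at this stage already gains this
    much, and the other gains are nonnegative. If no piece spans it, the gain is at least
    \<open>card (Js t)\<close>.\<close>
  have "int (crank x (Js t)) - int (d_zero x K Js) \<le> (\<Sum>i\<in>{1..K}. c i t)"
    if t: "t \<in> {1..K}" for t
  proof (cases "\<exists>i\<in>{1..K}. cspan x (Js t) \<subseteq> cspan x (P i t)")
    case True
    then obtain i where i: "i \<in> {1..K}" "cspan x (Js t) \<subseteq> cspan x (P i t)" by blast
    then have "int (crank x (Js t)) - int (d_zero x K Js) \<le> c i t"
      using crank_Un_spanning[OF part t P_out[OF t], of x i "J i \<inter> Js t"]
      unfolding c_def P_step[OF t, symmetric] by auto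
    also have "\<dots> \<le> (\<Sum>i\<in>{1..K}. c i t)"
      using i c_nonneg t by (intro member_le_sum) auto
    finally show ?thesis .
  next
    case False
    then have "int (card (Js t)) \<le> (\<Sum>i\<in>{1..K}. c i t)" using unspanned t by blast
    moreover have "crank x (Js t) \<le> card (Js t)" using sizes t by fastforce
    ultimately show ?thesis by linarith
  qed
  then have "(\<Sum>t\<in>{1..K} - {k}. int (crank x (Js t)) - int (d_zero x K Js))
      \<le> (\<Sum>t\<in>{1..K} - {k}. \<Sum>i\<in>{1..K}. c i t)"
    by (intro sum_mono) auto
  moreover have "(\<Sum>t\<in>{1..K} - {k}. int (crank x (Js t)) - int (d_zero x K Js))
      = (\<Sum>t\<in>{1..K} - {k}. int (crank x (Js t))) - int ((K - 1) * d_zero x K Js)"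
    using k by (simp add: sum_subtractf)
  \<comment> \<open>Segment \<open>k\<close> stays unspanned at its stage because
    \<open>P i k\<close> is part of \<open>J i\<close>. Its surplus of more than
    \<open>(K - 1) * d_zero x K Js\<close> outweighs the loss of \<open>d_zero\<close> at each of
    the \<open>K - 1\<close> other segments, so the total rank is too large.\<close>
  moreover have "int (crank x (Js k)) + int ((K - 1) * d_zero x K Js) < (\<Sum>i\<in>{1..K}. c i k)"
  proof -
    have "\<not> cspan x (Js k) \<subseteq> cspan x (P i k)" if "i \<in> {1..K}" for i
      using no_span that cspan_mono[of "P i k" "J i" x] unfolding P_def by blast
    then have "int (card (Js k)) \<le> (\<Sum>i\<in>{1..K}. c i k)" using unspanned k by blast
    moreover have "crank x (Js k) + (K - 1) * d_zero x K Js < card (Js k)"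
      using sizes k by blast
    ultimately show ?thesis by linarith
  qed
  moreover have "(\<Sum>t\<in>{1..K}. \<Sum>i\<in>{1..K}. c i t)
      = (\<Sum>i\<in>{1..K}. c i k) + (\<Sum>t\<in>{1..K} - {k}. \<Sum>i\<in>{1..K}. c i t)"
    using k by (intro sum.remove) auto
  moreover have "(\<Sum>t\<in>{1..K}. int (crank x (Js t)))
      = int (crank x (Js k)) + (\<Sum>t\<in>{1..K} - {k}. int (crank x (Js t)))"
    using k by (intro sum.remove) auto
  moreover have "(\<Sum>t\<in>{1..K}. \<Sum>i\<in>{1..K}. c i t) = (\<Sum>i\<in>{1..K}. int (crank x (J i)))"
    using c_sum by (subst sum.swap) simp
  moreover have "(\<Sum>i\<in>{1..K}. int (crank x (J i))) \<le> (\<Sum>t\<in>{1..K}. int (crank x (Js t)))"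
    using rank by (metis of_nat_le_iff of_nat_sum)
  ultimately show False by linarith
qed

section \<open>Segment extension: a single step and the whole pass\<close>

lemma extension_superset: "I \<subseteq> {1..n} \<Longrightarrow> I \<subseteq> extension x n I"
  by (auto simp: extension_def cspan_superset)

lemma cspan_extension: "I \<subseteq> {1..n} \<Longrightarrow> cspan x (extension x n I) = cspan x I"
  by (intro equalityI cspan_minimal cspan_mono extension_superset)
    (auto simp: extension_def subspace_cspan)

text \<open>Segment extension is the identity on a piece that is not extendable, so the test for
  extendability disappears from later case distinctions.\<close>

lemma extension_step_eq:
  assumes "J i \<subseteq> {1..n}"
  shows "extension_step x n i J = (if J i = {} then J else segment_extension x n i J)"
proof (cases "extendable x n (J i)")
  case False
  then have "extension x n (J i) = J i"
    using extension_superset[OF assms] by (auto simp: extendable_def extension_def)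
  then have "segment_extension x n i J = J"
    by (simp add: segment_extension_def fun_eq_iff)
  with False show ?thesis by (simp add: extension_step_def)
qed (auto simp: extension_step_def)

lemma extension_step_subset: "l \<noteq> i \<Longrightarrow> extension_step x n i J l \<subseteq> J l"
  by (auto simp: extension_step_def segment_extension_def)

lemma extension_step_cover:
  assumes "i \<in> {1..K}" "(\<Union>l\<in>{1..K}. J l) = {1..n}"
  shows "(\<Union>l\<in>{1..K}. extension_step x n i J l) = {1..n}"
proof (cases "J i = {}")
  case False
  have Ji: "J i \<subseteq> {1..n}" using assms by blast
  let ?E = "extension x n (J i)"
  have "(\<Union>l\<in>{1..K}. segment_extension x n i J l) = ?E \<union> (\<Union>l\<in>{1..K} - {i}. J l - (?E - J i))"
    using assms(1) by (auto simp: segment_extension_def)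
  also have "\<dots> = {1..n}"
  proof
    show "?E \<union> (\<Union>l\<in>{1..K} - {i}. J l - (?E - J i)) \<subseteq> {1..n}"
      using assms(2) by (auto simp: extension_def)
    show "{1..n} \<subseteq> ?E \<union> (\<Union>l\<in>{1..K} - {i}. J l - (?E - J i))"
      using assms(2) extension_superset[OF Ji, of x] by blast
  qed
  finally show ?thesis using False by (simp add: extension_step_eq[where J=J and i=i, OF Ji])
qed (use assms in \<open>simp add: extension_step_def\<close>)

lemma extension_step_disjoint:
  assumes disj: "disjoint_family_on J {1..K}"
  shows "disjoint_family_on (extension_step x n i J) {1..K}"
proof -
  have "segment_extension x n i J a \<inter> segment_extension x n i J b = {}"
    if "a \<in> {1..K}" "b \<in> {1..K}" "a \<noteq> b" for a b
  proof -
    have "J a \<inter> J b = {}" using disj that by (rule disjoint_family_onD)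
    then show ?thesis
      using that(3) unfolding segment_extension_def by (cases "a = i"; cases "b = i") auto
  qed
  then have "disjoint_family_on (segment_extension x n i J) {1..K}"
    unfolding disjoint_family_on_def by blast
  with disj show ?thesis by (simp add: extension_step_def)
qed

text \<open>The extended piece keeps its span and every other piece can only shrink.\<close>

lemma crank_extension_step_le:
  assumes "J i \<subseteq> {1..n}"
  shows "crank x (extension_step x n i J l) \<le> crank x (J l)"
proof (cases "l = i")
  case True
  then show ?thesis
    using cspan_extension[where x=x, OF assms]
    by (simp add: extension_step_def segment_extension_def flip: dim_cspan)
next
  case False
  then show ?thesis by (intro crank_mono extension_step_subset)
qed

text \<open>If piece \<open>i\<close> spans the segment, its extension takes in the whole of
  \<open>Js k\<close>, possibly away from piece \<open>l\<close>. If not,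
  \<open>mem_cspan_imp_mem\<close> shows that it takes no new column of \<open>Js k\<close>, which
  therefore stays where it was.\<close>

lemma extension_step_keeps_whole:
  assumes nondeg: "intersected_nondegenerately x n K Js" and Js: "Js k \<subseteq> {1..n}"
    and k: "k \<in> {1..K}" and i: "i \<in> {1..K}"
    and J: "\<forall>l\<in>{1..K}. J l \<subseteq> {1..n}" "disjoint_family_on J {1..K}"
    and whole: "\<exists>l\<in>{1..K}. Js k \<subseteq> J l"
  shows "\<exists>l\<in>{1..K}. Js k \<subseteq> extension_step x n i J l"
proof -
  obtain l where l: "l \<in> {1..K}" "Js k \<subseteq> J l" using whole by blast
  have Ji: "J i \<subseteq> {1..n}" using J i by blast
  note sup = extension_superset[OF Ji, of x]
  consider "J i = {}" | "l = i" "J i \<noteq> {}" | "cspan x (Js k) \<subseteq> cspan x (J i)" "J i \<noteq> {}"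
    | "l \<noteq> i" "J i \<noteq> {}" "\<not> cspan x (Js k) \<subseteq> cspan x (J i)"
    by blast
  then show ?thesis
  proof cases
    case 1
    then show ?thesis using l by (auto simp: extension_step_eq[where J=J and i=i, OF Ji])
  next
    case 2
    have "Js k \<subseteq> extension x n (J i)" using l sup 2 by blast
    then show ?thesis
      using 2 i by (auto simp: extension_step_eq[where J=J and i=i, OF Ji] segment_extension_def)
  next
    case 3
    then have "Js k \<subseteq> extension x n (J i)"
      using Js cspan_superset[of _ "Js k" x] by (auto simp: extension_def)
    then show ?thesis
      using 3 i by (auto simp: extension_step_eq[where J=J and i=i, OF Ji] segment_extension_def)
  next
    case 4
    have fin: "finite (Js k)" using Js finite_subset by blast
    have "j \<in> J i" if "j \<in> Js k" "j \<in> extension x n (J i)" for j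
      using mem_cspan_imp_mem[OF nondeg fin k Ji 4(3) that(1)] that(2)
      by (simp add: extension_def)
    then have "Js k \<subseteq> segment_extension x n i J l"
      using l 4(1) by (auto simp: segment_extension_def)
    then show ?thesis using 4 l by (auto simp: extension_step_eq[where J=J and i=i, OF Ji])
  qed
qed

text \<open>A zero column lies in every subspace, so a second segment would put it into a forbidden
  intersection. This settles the case of an empty piece, whose span is the zero subspace.\<close>

lemma cspan_zero_imp_unique_index:
  assumes mss: "is_MSS x n K Js"
    and not_in_intersections:
      "\<forall>j\<in>{1..n}. \<forall>k\<in>{1..K}. \<forall>l\<in>{1..K}. k \<noteq> l \<longrightarrow> x j \<notin> cspan x (Js k) \<inter> cspan x (Js l)"
    and k: "k \<in> {1..K}" and zero: "cspan x (Js k) \<subseteq> {0}" and l: "l \<in> {1..K}"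
  shows "l = k"
proof (rule ccontr)
  assume "l \<noteq> k"
  obtain j where j: "j \<in> Js k" "j \<in> {1..n}"
    using mss k unfolding is_MSS_def indexed_partition_def by blast
  have "x j = 0" using zero j cspan_superset by blast
  then have "x j \<in> cspan x (Js k) \<inter> cspan x (Js l)"
    using subspace_0[OF subspace_cspan] by (metis IntI)
  then show False using not_in_intersections j k l \<open>l \<noteq> k\<close> by blast
qed

text \<open>A nonempty piece, just extended, contains every column in its span, in particular those
  of \<open>Js k\<close>.\<close>

lemma extension_step_spanned_imp_whole:
  assumes mss: "is_MSS x n K Js"
    and not_in_intersections:
      "\<forall>j\<in>{1..n}. \<forall>k\<in>{1..K}. \<forall>l\<in>{1..K}. k \<noteq> l \<longrightarrow> x j \<notin> cspan x (Js k) \<inter> cspan x (Js l)"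
    and k: "k \<in> {1..K}" and i: "i \<in> {1..K}" and cover: "(\<Union>l\<in>{1..K}. J l) = {1..n}"
    and spanned: "cspan x (Js k) \<subseteq> cspan x (extension_step x n i J i)"
  shows "\<exists>l\<in>{1..K}. Js k \<subseteq> extension_step x n i J l"
proof (cases "J i = {}")
  case True
  \<comment> \<open>An empty piece is not extended and spans only 0. Then \<open>i\<close> is the
    only index and the empty piece must cover \<open>{1..n}\<close>, contradicting that
    \<open>Js k\<close> is nonempty.\<close>
  then have "cspan x (Js k) \<subseteq> {0}"
    using spanned by (simp add: extension_step_def cspan_def)
  then have "{1..K} = {i}"
    using cspan_zero_imp_unique_index[OF mss not_in_intersections k] i by blast
  then have "{1..n} = {}" using cover True by simp
  then show ?thesis
    using mss k unfolding is_MSS_def indexed_partition_def by blast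
next
  case False
  have Ji: "J i \<subseteq> {1..n}" using cover i by blast
  have "Js k \<subseteq> {1..n}" using mss k unfolding is_MSS_def indexed_partition_def by blast
  moreover have "extension_step x n i J i = extension x n (J i)"
    using False by (simp add: extension_step_eq[where J=J and i=i, OF Ji] segment_extension_def)
  moreover have "cspan x (extension x n (J i)) = cspan x (J i)"
    by (rule cspan_extension[OF Ji])
  ultimately have "Js k \<subseteq> extension_step x n i J i"
    using spanned cspan_superset[of _ "Js k" x] by (auto simp: extension_def)
  then show ?thesis using i by blast
qed

text \<open>Pieces shrink once they have been extended, but the \<open>X\<^sub>k\<close> are only moved as a whole. So
  the last conclusion passes on to the pieces extended before, although the \<open>X\<^sub>k\<close> that such a
  piece spans may since have gone to another piece.\<close>

lemma extend_one_by_one_invariant: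
  assumes mss: "is_MSS x n K Js"
    and not_in_intersections:
      "\<forall>j\<in>{1..n}. \<forall>k\<in>{1..K}. \<forall>l\<in>{1..K}. k \<noteq> l \<longrightarrow> x j \<notin> cspan x (Js k) \<inter> cspan x (Js l)"
    and nondeg: "intersected_nondegenerately x n K Js"
    and cover: "(\<Union>l\<in>{1..K}. J l) = {1..n}" and disj: "disjoint_family_on J {1..K}"
    and ord: "set ord \<subseteq> {1..K}"
  defines "Jt \<equiv> extend_one_by_one x n ord J"
  shows "(\<Union>l\<in>{1..K}. Jt l) = {1..n}" and "disjoint_family_on Jt {1..K}"
    and "(\<Sum>i\<in>{1..K}. crank x (Jt i)) \<le> (\<Sum>i\<in>{1..K}. crank x (J i))"
    and "\<And>i k. i \<in> set ord \<Longrightarrow> k \<in> {1..K} \<Longrightarrow> cspan x (Js k) \<subseteq> cspan x (Jt i) \<Longrightarrow>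
           \<exists>l\<in>{1..K}. Js k \<subseteq> Jt l"
proof -
  have "(\<Union>l\<in>{1..K}. Jt l) = {1..n} \<and> disjoint_family_on Jt {1..K} \<and>
      (\<Sum>i\<in>{1..K}. crank x (Jt i)) \<le> (\<Sum>i\<in>{1..K}. crank x (J i)) \<and>
      (\<forall>i\<in>set ord. \<forall>k\<in>{1..K}. cspan x (Js k) \<subseteq> cspan x (Jt i) \<longrightarrow> (\<exists>l\<in>{1..K}. Js k \<subseteq> Jt l))"
    using ord unfolding Jt_def
  \<comment> \<open>\<open>fold\<close> handles the last list element last, so induction from the
    right isolates the final extension step.\<close>
  proof (induction ord rule: rev_induct)
    case Nil
    then show ?case using cover disj by (simp add: extend_one_by_one_def)
  next
    case (snoc i ord)
    define J' where "J' = extend_one_by_one x n ord J"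
    have step: "extend_one_by_one x n (ord @ [i]) J = extension_step x n i J'"
      by (simp add: extend_one_by_one_def J'_def)
    have i: "i \<in> {1..K}" using snoc.prems by simp
    have IH: "(\<Union>l\<in>{1..K}. J' l) = {1..n}" "disjoint_family_on J' {1..K}"
        "(\<Sum>i\<in>{1..K}. crank x (J' i)) \<le> (\<Sum>i\<in>{1..K}. crank x (J i))"
        "\<forall>a\<in>set ord. \<forall>k\<in>{1..K}. cspan x (Js k) \<subseteq> cspan x (J' a) \<longrightarrow> (\<exists>l\<in>{1..K}. Js k \<subseteq> J' l)"
      using snoc unfolding J'_def by simp_all
    have J'_sub: "\<forall>l\<in>{1..K}. J' l \<subseteq> {1..n}" using IH(1) by blast
    have "(\<Sum>l\<in>{1..K}. crank x (extension_step x n i J' l)) \<le> (\<Sum>l\<in>{1..K}. crank x (J' l))"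
      using J'_sub i by (intro sum_mono crank_extension_step_le) blast
    with IH(3) have "(\<Sum>l\<in>{1..K}. crank x (extension_step x n i J' l)) \<le> (\<Sum>l\<in>{1..K}. crank x (J l))"
      by (rule order_trans[rotated])
    moreover have "\<exists>l\<in>{1..K}. Js k \<subseteq> extension_step x n i J' l"
      if a: "a \<in> set (ord @ [i])" and k: "k \<in> {1..K}"
        and sp: "cspan x (Js k) \<subseteq> cspan x (extension_step x n i J' a)" for a k
    proof (cases "a = i")
      case True
      then show ?thesis
        using extension_step_spanned_imp_whole[OF mss not_in_intersections k i IH(1)] sp
        by blast
    next
      case False
      have Jsk: "Js k \<subseteq> {1..n}" using mss k unfolding is_MSS_def indexed_partition_def by blast
      \<comment> \<open>Piece \<open>a\<close> was extended earlier and can only have shrunk in this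
        step, so it spanned the segment before.\<close>
      have "cspan x (Js k) \<subseteq> cspan x (J' a)"
        using sp cspan_mono[OF extension_step_subset[OF False]] by blast
      then have "\<exists>l\<in>{1..K}. Js k \<subseteq> J' l" using IH(4) a k False by auto
      then show ?thesis
        by (rule extension_step_keeps_whole[OF nondeg Jsk k i J'_sub IH(2)])
    qed
    ultimately show ?case
      unfolding step
      using extension_step_cover[OF i IH(1)] extension_step_disjoint[OF IH(2)]
      by (intro conjI ballI impI)
  qed
  then show "(\<Union>l\<in>{1..K}. Jt l) = {1..n}" "disjoint_family_on Jt {1..K}"
    "(\<Sum>i\<in>{1..K}. crank x (Jt i)) \<le> (\<Sum>i\<in>{1..K}. crank x (J i))"
    "\<And>i k. i \<in> set ord \<Longrightarrow> k \<in> {1..K} \<Longrightarrow> cspan x (Js k) \<subseteq> cspan x (Jt i) \<Longrightarrow>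
       \<exists>l\<in>{1..K}. Js k \<subseteq> Jt l"
    by blast+
qed

section \<open>Comparing the two partitions\<close>

text \<open>Send \<open>k\<close> to the index of a set \<open>B i\<close> containing
  \<open>A k\<close>. Every \<open>B i\<close> is nonempty and covered, so this map is onto the
  finite set \<open>I\<close> and hence injective. Each \<open>B i\<close> thus receives a single
  \<open>A k\<close> and equals it.\<close>

lemma coarser_partition_image_eq:
  assumes fin: "finite I" and ne: "\<And>i. i \<in> I \<Longrightarrow> B i \<noteq> {}"
    and cover: "(\<Union>k\<in>I. A k) = (\<Union>i\<in>I. B i)" and disj: "disjoint_family_on B I"
    and whole: "\<And>k. k \<in> I \<Longrightarrow> \<exists>i\<in>I. A k \<subseteq> B i"
  shows "B ` I = A ` I"
proof -
  obtain f where f: "\<And>k. k \<in> I \<Longrightarrow> f k \<in> I" "\<And>k. k \<in> I \<Longrightarrow> A k \<subseteq> B (f k)"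
    using whole by metis
  have hit: "\<exists>k\<in>I. i = f k \<and> j \<in> A k" if "i \<in> I" "j \<in> B i" for i j
  proof -
    have "j \<in> (\<Union>k\<in>I. A k)" unfolding cover using that by blast
    then obtain k where k: "k \<in> I" "j \<in> A k" by blast
    have "j \<in> B (f k)" using f(2)[OF k(1)] k(2) by blast
    then have "i = f k"
      using disjoint_family_onD[OF disj that(1) f(1)[OF k(1)]] that(2) by blast
    with k show ?thesis by blast
  qed
  have "f ` I = I"
  proof
    show "I \<subseteq> f ` I"
    proof
      fix i assume i: "i \<in> I"
      then obtain j where "j \<in> B i" using ne by blast
      then show "i \<in> f ` I" using hit[OF i] by blast
    qed
  qed (use f(1) in blast)
  then have inj: "inj_on f I" using eq_card_imp_inj_on[OF fin, of f] by simp
  have "B (f k) = A k" if k: "k \<in> I" for k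
  proof
    show "B (f k) \<subseteq> A k"
    proof
      fix j assume "j \<in> B (f k)"
      then obtain k' where "k' \<in> I" "f k = f k'" "j \<in> A k'" using hit[OF f(1)[OF k]] by blast
      then show "j \<in> A k" using inj_onD[OF inj _ k, of k'] by simp
    qed
  qed (fact f(2)[OF k])
  then have "B ` (f ` I) = A ` I" unfolding image_image by (intro image_cong) auto
  then show ?thesis using \<open>f ` I = I\<close> by simp
qed

theorem theorem7:
  fixes x :: "nat \<Rightarrow> real ^ 'm" and n K d :: nat
    and Js J Jt :: "nat \<Rightarrow> nat set" and ord :: "nat list"
  assumes mss: "is_MSS x n K Js"
    and not_in_intersections:
      "\<forall>j\<in>{1..n}. \<forall>k\<in>{1..K}. \<forall>l\<in>{1..K}. k \<noteq> l \<longrightarrow> x j \<notin> cspan x (Js k) \<inter> cspan x (Js l)"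
    and nondeg: "intersected_nondegenerately x n K Js"
    and d: "d = (\<Sum>k\<in>{1..K}. crank x (Js k))"
    and sizes: "\<forall>k\<in>{1..K}. card (Js k) > crank x (Js k) + (K - 1) * d_zero x K Js"
    and J: "J \<in> candidates x n K d (d_min x K Js)"
    and order: "distinct ord" "set ord = {1..K}"
    and Jt: "Jt = extend_one_by_one x n ord J"
  shows "(\<forall>i\<in>{1..K}. Jt i \<noteq> {} \<longrightarrow> (\<exists>L\<subseteq>{1..K}. Jt i = (\<Union>k\<in>L. Js k))) \<and>
         ((\<forall>i\<in>{1..K}. Jt i \<noteq> {}) \<longrightarrow> Jt ` {1..K} = Js ` {1..K})"
proof -
  have part: "indexed_partition n K Js" using mss by (simp add: is_MSS_def)
  have Js_cover: "(\<Union>k\<in>{1..K}. Js k) = {1..n}" using part by (simp add: indexed_partition_def)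
  have J_part: "indexed_partition n K J" and J_rank: "(\<Sum>k\<in>{1..K}. crank x (J k)) \<le> d"
    using J by (simp_all add: candidates_def)
  have J_cover: "(\<Union>k\<in>{1..K}. J k) = {1..n}" and J_disj: "disjoint_family_on J {1..K}"
    using J_part by (simp_all add: indexed_partition_def)
  note inv = extend_one_by_one_invariant[where ord=ord, OF mss not_in_intersections nondeg J_cover J_disj,
      folded Jt, unfolded order(2), OF subset_refl]
  have Jt_rank: "(\<Sum>i\<in>{1..K}. crank x (Jt i)) \<le> (\<Sum>k\<in>{1..K}. crank x (Js k))"
    using inv(3) J_rank d by linarith
  \<comment> \<open>The rank count yields a piece spanning segment \<open>k\<close>. As
    \<open>ord\<close> runs through all pieces, the invariant applies to it and places
    \<open>Js k\<close> inside one piece, perhaps a different one.\<close>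
  have whole: "\<exists>i\<in>{1..K}. Js k \<subseteq> Jt i" if k: "k \<in> {1..K}" for k
    using exists_spanning_piece[OF part nondeg sizes inv(1,2) Jt_rank k] inv(4) k by blast
  have "Jt i = (\<Union>k\<in>{k\<in>{1..K}. Js k \<subseteq> Jt i}. Js k)" if i: "i \<in> {1..K}" for i
  proof
    show "Jt i \<subseteq> (\<Union>k\<in>{k\<in>{1..K}. Js k \<subseteq> Jt i}. Js k)"
    proof
      fix j assume j: "j \<in> Jt i"
      then obtain k where k: "k \<in> {1..K}" "j \<in> Js k" using Js_cover inv(1) i by blast
      then obtain l where l: "l \<in> {1..K}" "Js k \<subseteq> Jt l" using whole by blast
      \<comment> \<open>The pieces are disjoint, and \<open>j\<close> lies both in
        \<open>Jt i\<close> and, through \<open>Js k\<close>, in \<open>Jt l\<close>.\<close>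
      then have "l = i" using inv(2) i j k unfolding disjoint_family_on_def by blast
      then show "j \<in> (\<Union>k\<in>{k\<in>{1..K}. Js k \<subseteq> Jt i}. Js k)" using k l by blast
    qed
  qed blast
  then have "\<exists>L\<subseteq>{1..K}. Jt i = (\<Union>k\<in>L. Js k)" if "i \<in> {1..K}" for i
    using that by (intro exI[of _ "{k\<in>{1..K}. Js k \<subseteq> Jt i}"]) auto
  moreover have "Jt ` {1..K} = Js ` {1..K}" if "\<forall>i\<in>{1..K}. Jt i \<noteq> {}"
    using that inv(1,2) Js_cover whole by (intro coarser_partition_image_eq) auto
  ultimately show ?thesis by blast
qed

end
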